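(* Let $F\colon\mathbf{C}\to\mathbf{C}$ be an endofunctor on a category $\mathbf{C}$. The category of $F$-coalgebras is isomorphic to the category of $(\mathbb{N},+,0)$-graded coalgebras for the $(\mathbb{N},+,0)$-graded monad $(F^n)_{n\in\mathbb{N}}$.
   Context: An $F$-coalgebra is an object $X$ with a morphism $X\to FX$; homomorphisms are the usual ones. A monad $M$ graded by a monoid $(T,\cdot,e)$ on $\mathbf{C}$ consists of endofunctors $M_t$ ($t\in T$), natural transformations $\mu^{s,t}\colon M_sM_t\to M_{s\cdot t}$ and $\eta\colon\mathrm{Id}\to M_e$ such that $\mu^{r,s\cdot t}\circ M_r\mu^{s,t}=\mu^{r\cdot s,t}\circ\mu^{r,s}M_t$ and $\mu^{t,e}\circ M_t\eta=\mathrm{id}=\mu^{e,t}\circ\eta M_t$. The graded monad $(F^n)_{n\in\mathbb{N}}$ has as components the $n$-fold composites $F^n$ and as multiplications and unit the identities $F^mF^n=F^{m+n}$ and $\mathrm{Id}=F^0$. A graded coalgebra of $M$ is an object $X$ with morphisms $\gamma_t\colon X\to M_tX$ ($t\in T$) such that $\gamma_e=\eta_X$ and $\gamma_{s\cdot t}=\mu^{s,t}_X\circ M_s\gamma_t\circ\gamma_s$. A homomorphism $h\colon(X,\gamma)\to(Y,\delta)$ is a morphism $h\colon X\to Y$ with $M_th\circ\gamma_t=\delta_t\circ h$ for all $t$. *)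

theory Defs
  imports Main
begin

section \<open>Categories, functors and natural transformations\<close>

text \<open>A category is given by carrier sets of objects and of arrows inside arbitrary types; values of
  the operations outside these carriers are irrelevant. \<open>Comp C g f\<close> is the composite
  \<open>g \<circ> f\<close>.\<close>

record ('o, 'm) cat =
  Obj :: "'o set"
  Arr :: "'m set"
  Dom :: "'m \<Rightarrow> 'o"
  Cod :: "'m \<Rightarrow> 'o"
  Idn :: "'o \<Rightarrow> 'm"
  Comp :: "'m \<Rightarrow> 'm \<Rightarrow> 'm"

definition Hom :: "('o, 'm) cat \<Rightarrow> 'o \<Rightarrow> 'o \<Rightarrow> 'm set" where
  "Hom C X Y = {f \<in> Arr C. Dom C f = X \<and> Cod C f = Y}"

locale category =
  fixes C :: "('o, 'm) cat"
  assumes Dom_in_Obj: "f \<in> Arr C \<Longrightarrow> Dom C f \<in> Obj C"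
    and Cod_in_Obj: "f \<in> Arr C \<Longrightarrow> Cod C f \<in> Obj C"
    and Idn_in_Hom: "X \<in> Obj C \<Longrightarrow> Idn C X \<in> Hom C X X"
    and Comp_in_Hom: "\<lbrakk>f \<in> Hom C X Y; g \<in> Hom C Y Z\<rbrakk> \<Longrightarrow> Comp C g f \<in> Hom C X Z"
    and Comp_Idn_left: "f \<in> Hom C X Y \<Longrightarrow> Comp C (Idn C Y) f = f"
    and Comp_Idn_right: "f \<in> Hom C X Y \<Longrightarrow> Comp C f (Idn C X) = f"
    and Comp_assoc: "\<lbrakk>f \<in> Hom C W X; g \<in> Hom C X Y; h \<in> Hom C Y Z\<rbrakk>
      \<Longrightarrow> Comp C h (Comp C g f) = Comp C (Comp C h g) f"

record ('o, 'm, 'p, 'n) fctr =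
  FObj :: "'o \<Rightarrow> 'p"
  FArr :: "'m \<Rightarrow> 'n"

locale cat_functor = C: category C + D: category D
  for C :: "('o, 'm) cat" and D :: "('p, 'n) cat" +
  fixes F :: "('o, 'm, 'p, 'n) fctr"
  assumes FObj_in_Obj: "X \<in> Obj C \<Longrightarrow> FObj F X \<in> Obj D"
    and FArr_in_Hom: "f \<in> Hom C X Y \<Longrightarrow> FArr F f \<in> Hom D (FObj F X) (FObj F Y)"
    and FArr_Idn: "X \<in> Obj C \<Longrightarrow> FArr F (Idn C X) = Idn D (FObj F X)"
    and FArr_Comp: "\<lbrakk>f \<in> Hom C X Y; g \<in> Hom C Y Z\<rbrakk>
      \<Longrightarrow> FArr F (Comp C g f) = Comp D (FArr F g) (FArr F f)"

definition id_fctr :: "('o, 'm, 'o, 'm) fctr" where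
  "id_fctr = \<lparr>FObj = (\<lambda>X. X), FArr = (\<lambda>f. f)\<rparr>"

definition comp_fctr ::
    "('p, 'n, 'q, 'k) fctr \<Rightarrow> ('o, 'm, 'p, 'n) fctr \<Rightarrow> ('o, 'm, 'q, 'k) fctr" where
  "comp_fctr G F = \<lparr>FObj = (\<lambda>X. FObj G (FObj F X)), FArr = (\<lambda>f. FArr G (FArr F f))\<rparr>"

primrec pow_fctr :: "('o, 'm, 'o, 'm) fctr \<Rightarrow> nat \<Rightarrow> ('o, 'm, 'o, 'm) fctr" where
  "pow_fctr F 0 = id_fctr"
| "pow_fctr F (Suc n) = comp_fctr F (pow_fctr F n)"

locale nat_trans = F: cat_functor C D F + G: cat_functor C D G
  for C :: "('o, 'm) cat" and D :: "('p, 'n) cat"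
    and F :: "('o, 'm, 'p, 'n) fctr" and G :: "('o, 'm, 'p, 'n) fctr" +
  fixes \<alpha> :: "'o \<Rightarrow> 'n"
  assumes component_in_Hom: "X \<in> Obj C \<Longrightarrow> \<alpha> X \<in> Hom D (FObj F X) (FObj G X)"
    and naturality: "f \<in> Hom C X Y \<Longrightarrow> Comp D (\<alpha> Y) (FArr F f) = Comp D (FArr G f) (\<alpha> X)"

text \<open>Functors \<open>F\<close> and \<open>G\<close> mutually inverse on the carriers.\<close>

definition cat_isomorphic :: "('o, 'm) cat \<Rightarrow> ('p, 'n) cat \<Rightarrow> bool" where
  "cat_isomorphic C D \<longleftrightarrow>
    (\<exists>F G. cat_functor C D F \<and> cat_functor D C G \<and>
      (\<forall>X\<in>Obj C. FObj G (FObj F X) = X) \<and> (\<forall>f\<in>Arr C. FArr G (FArr F f) = f) \<and>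
      (\<forall>Y\<in>Obj D. FObj F (FObj G Y) = Y) \<and> (\<forall>g\<in>Arr D. FArr F (FArr G g) = g))"

section \<open>Graded monads\<close>

record ('t, 'o, 'm) gmonad =
  GFun :: "'t \<Rightarrow> ('o, 'm, 'o, 'm) fctr"
  Mult :: "'t \<Rightarrow> 't \<Rightarrow> 'o \<Rightarrow> 'm"
  Unit :: "'o \<Rightarrow> 'm"

text \<open>The grading monoid is carried by the whole type \<open>'t\<close>, with operation \<open>m\<close> and neutral
  element \<open>e\<close>. The first argument of \<open>Mult\<close> is the degree of the outer functor.\<close>

locale graded_monad = category C + T: monoid m e
  for C :: "('o, 'm) cat" and m :: "'t \<Rightarrow> 't \<Rightarrow> 't" and e :: "'t" +
  fixes M :: "('t, 'o, 'm) gmonad"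
  assumes GFun_functor: "cat_functor C C (GFun M t)"
    and Mult_natural: "nat_trans C C (comp_fctr (GFun M s) (GFun M t)) (GFun M (m s t)) (Mult M s t)"
    and Unit_natural: "nat_trans C C id_fctr (GFun M e) (Unit M)"
    and Mult_assoc: "X \<in> Obj C \<Longrightarrow>
      Comp C (Mult M r (m s t) X) (FArr (GFun M r) (Mult M s t X)) =
      Comp C (Mult M (m r s) t X) (Mult M r s (FObj (GFun M t) X))"
    and Unit_right: "X \<in> Obj C \<Longrightarrow>
      Comp C (Mult M t e X) (FArr (GFun M t) (Unit M X)) = Idn C (FObj (GFun M t) X)"
    and Unit_left: "X \<in> Obj C \<Longrightarrow>
      Comp C (Mult M e t X) (Unit M (FObj (GFun M t) X)) = Idn C (FObj (GFun M t) X)"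

definition pow_gmonad :: "('o, 'm) cat \<Rightarrow> ('o, 'm, 'o, 'm) fctr \<Rightarrow> (nat, 'o, 'm) gmonad" where
  "pow_gmonad C F =
    \<lparr>GFun = pow_fctr F,
     Mult = (\<lambda>i j X. Idn C (FObj (pow_fctr F (i + j)) X)),
     Unit = (\<lambda>X. Idn C X)\<rparr>"

section \<open>Coalgebras and graded coalgebras\<close>

text \<open>The category whose objects are the pairs in \<open>Ob\<close>, each consisting of an object of \<open>C\<close> and
  some structure on it, and whose morphisms are the arrows \<open>h\<close> of \<open>C\<close> between underlying objects
  that satisfy \<open>H A h B\<close>. Arrows are triples \<open>(A, h, B)\<close>, since one arrow of \<open>C\<close> may be a
  homomorphism between several pairs of structured objects.\<close>

definition structured_cat :: "('o, 'm) cat \<Rightarrow> ('o \<times> 's) set \<Rightarrow>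
    ('o \<times> 's \<Rightarrow> 'm \<Rightarrow> 'o \<times> 's \<Rightarrow> bool) \<Rightarrow> ('o \<times> 's, ('o \<times> 's) \<times> 'm \<times> ('o \<times> 's)) cat" where
  "structured_cat C Ob H =
    \<lparr>Obj = Ob,
     Arr = {(A, h, B). A \<in> Ob \<and> B \<in> Ob \<and> h \<in> Hom C (fst A) (fst B) \<and> H A h B},
     Dom = (\<lambda>(A, h, B). A),
     Cod = (\<lambda>(A, h, B). B),
     Idn = (\<lambda>A. (A, Idn C (fst A), A)),
     Comp = (\<lambda>(B', g, D) (A, f, B). (A, Comp C g f, D))\<rparr>"

definition coalg :: "('o, 'm) cat \<Rightarrow> ('o, 'm, 'o, 'm) fctr \<Rightarrow> 'o \<times> 'm \<Rightarrow> bool" where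
  "coalg C F = (\<lambda>(X, \<gamma>). X \<in> Obj C \<and> \<gamma> \<in> Hom C X (FObj F X))"

definition coalg_hom ::
    "('o, 'm) cat \<Rightarrow> ('o, 'm, 'o, 'm) fctr \<Rightarrow> 'o \<times> 'm \<Rightarrow> 'm \<Rightarrow> 'o \<times> 'm \<Rightarrow> bool" where
  "coalg_hom C F = (\<lambda>(X, \<gamma>) h (Y, \<delta>).
    h \<in> Hom C X Y \<and> Comp C (FArr F h) \<gamma> = Comp C \<delta> h)"

definition coalg_cat :: "('o, 'm) cat \<Rightarrow> ('o, 'm, 'o, 'm) fctr \<Rightarrow>
    ('o \<times> 'm, ('o \<times> 'm) \<times> 'm \<times> ('o \<times> 'm)) cat" where
  "coalg_cat C F = structured_cat C {A. coalg C F A} (coalg_hom C F)"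

definition gcoalg :: "('o, 'm) cat \<Rightarrow> ('t \<Rightarrow> 't \<Rightarrow> 't) \<Rightarrow> 't \<Rightarrow> ('t, 'o, 'm) gmonad \<Rightarrow>
    'o \<times> ('t \<Rightarrow> 'm) \<Rightarrow> bool" where
  "gcoalg C m e M = (\<lambda>(X, \<gamma>).
    X \<in> Obj C \<and>
    (\<forall>t. \<gamma> t \<in> Hom C X (FObj (GFun M t) X)) \<and>
    \<gamma> e = Unit M X \<and>
    (\<forall>s t. \<gamma> (m s t) = Comp C (Mult M s t X) (Comp C (FArr (GFun M s) (\<gamma> t)) (\<gamma> s))))"

definition gcoalg_hom :: "('o, 'm) cat \<Rightarrow> ('t, 'o, 'm) gmonad \<Rightarrow>
    'o \<times> ('t \<Rightarrow> 'm) \<Rightarrow> 'm \<Rightarrow> 'o \<times> ('t \<Rightarrow> 'm) \<Rightarrow> bool" where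
  "gcoalg_hom C M = (\<lambda>(X, \<gamma>) h (Y, \<delta>).
    h \<in> Hom C X Y \<and> (\<forall>t. Comp C (FArr (GFun M t) h) (\<gamma> t) = Comp C (\<delta> t) h))"

definition gcoalg_cat :: "('o, 'm) cat \<Rightarrow> ('t \<Rightarrow> 't \<Rightarrow> 't) \<Rightarrow> 't \<Rightarrow> ('t, 'o, 'm) gmonad \<Rightarrow>
    ('o \<times> ('t \<Rightarrow> 'm), ('o \<times> ('t \<Rightarrow> 'm)) \<times> 'm \<times> ('o \<times> ('t \<Rightarrow> 'm))) cat" where
  "gcoalg_cat C m e M = structured_cat C {A. gcoalg C m e M A} (gcoalg_hom C M)"

section \<open>Well-formedness\<close>

lemma (in category) Hom_objD: "f \<in> Hom C X Y \<Longrightarrow> X \<in> Obj C \<and> Y \<in> Obj C"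
  using Dom_in_Obj Cod_in_Obj by (auto simp: Hom_def)

lemma category_structured_cat:
  assumes "category C"
    and ob: "\<And>A. A \<in> Ob \<Longrightarrow> fst A \<in> Obj C"
    and H_id: "\<And>A. A \<in> Ob \<Longrightarrow> H A (Idn C (fst A)) A"
    and H_comp: "\<And>A B D f g. \<lbrakk>A \<in> Ob; B \<in> Ob; D \<in> Ob; f \<in> Hom C (fst A) (fst B);
      g \<in> Hom C (fst B) (fst D); H A f B; H B g D\<rbrakk> \<Longrightarrow> H A (Comp C g f) D"
  shows "category (structured_cat C Ob H)"
proof -
  interpret category C by fact
  let ?S = "structured_cat C Ob H"
  have hom: "x \<in> Hom ?S A B \<longleftrightarrow>
      (\<exists>h. x = (A, h, B) \<and> A \<in> Ob \<and> B \<in> Ob \<and> h \<in> Hom C (fst A) (fst B) \<and> H A h B)" for x A B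
    unfolding Hom_def[of ?S] by (auto simp: structured_cat_def)
  have idn: "Idn ?S A = (A, Idn C (fst A), A)" for A
    by (simp add: structured_cat_def)
  have comp: "Comp ?S (B', g, D) (A, f, B) = (A, Comp C g f, D)" for B' g D A f B
    by (simp add: structured_cat_def)
  show ?thesis
  proof
    show "Dom ?S f \<in> Obj ?S" if "f \<in> Arr ?S" for f
      using that by (auto simp: structured_cat_def)
    show "Cod ?S f \<in> Obj ?S" if "f \<in> Arr ?S" for f
      using that by (auto simp: structured_cat_def)
    show "Idn ?S A \<in> Hom ?S A A" if "A \<in> Obj ?S" for A
    proof -
      from that have "A \<in> Ob" by (simp add: structured_cat_def)
      then show ?thesis by (auto simp: hom idn intro: ob H_id Idn_in_Hom)
    qed
    show "Comp ?S g f \<in> Hom ?S A D" if "f \<in> Hom ?S A B" "g \<in> Hom ?S B D" for f g A B D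
      using that by (auto simp: hom comp intro: H_comp Comp_in_Hom)
    show "Comp ?S (Idn ?S B) f = f" if "f \<in> Hom ?S A B" for f A B
      using that by (auto simp: hom comp idn intro: Comp_Idn_left)
    show "Comp ?S f (Idn ?S A) = f" if "f \<in> Hom ?S A B" for f A B
      using that by (auto simp: hom comp idn intro: Comp_Idn_right)
    show "Comp ?S h (Comp ?S g f) = Comp ?S (Comp ?S h g) f"
      if "f \<in> Hom ?S A B" "g \<in> Hom ?S B D" "h \<in> Hom ?S D E" for f g h A B D E
      using that by (auto simp: hom comp intro: Comp_assoc)
  qed
qed

lemma cat_functor_id: "category C \<Longrightarrow> cat_functor C C id_fctr"
  by (simp add: cat_functor_def cat_functor_axioms_def id_fctr_def)

lemma cat_functor_comp:
  assumes "cat_functor C D F" "cat_functor D E G"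
  shows "cat_functor C E (comp_fctr G F)"
proof -
  interpret F: cat_functor C D F by fact
  interpret G: cat_functor D E G by fact
  show ?thesis
  proof
    show "FObj (comp_fctr G F) X \<in> Obj E" if "X \<in> Obj C" for X
      using G.FObj_in_Obj[OF F.FObj_in_Obj[OF that]] by (simp add: comp_fctr_def)
    show "FArr (comp_fctr G F) f \<in> Hom E (FObj (comp_fctr G F) X) (FObj (comp_fctr G F) Y)"
      if "f \<in> Hom C X Y" for f X Y
      using G.FArr_in_Hom[OF F.FArr_in_Hom[OF that]] by (simp add: comp_fctr_def)
    show "FArr (comp_fctr G F) (Idn C X) = Idn E (FObj (comp_fctr G F) X)" if "X \<in> Obj C" for X
      using that by (simp add: comp_fctr_def F.FArr_Idn G.FArr_Idn F.FObj_in_Obj)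
    show "FArr (comp_fctr G F) (Comp C g f) =
        Comp E (FArr (comp_fctr G F) g) (FArr (comp_fctr G F) f)"
      if "f \<in> Hom C X Y" "g \<in> Hom C Y Z" for f g X Y Z
      using F.FArr_Comp[OF that] G.FArr_Comp[OF that[THEN F.FArr_in_Hom]]
      by (simp add: comp_fctr_def)
  qed
qed

lemma cat_functor_pow: "cat_functor C C F \<Longrightarrow> cat_functor C C (pow_fctr F n)"
  by (induction n) (auto intro: cat_functor_id cat_functor_comp simp: cat_functor_def[of C C F])

lemma pow_fctr_add: "comp_fctr (pow_fctr F i) (pow_fctr F j) = pow_fctr F (i + j)"
proof (induction i)
  case 0
  show ?case by (simp add: id_fctr_def comp_fctr_def)
next
  case (Suc i)
  have "comp_fctr (comp_fctr F (pow_fctr F i)) (pow_fctr F j) =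
      comp_fctr F (comp_fctr (pow_fctr F i) (pow_fctr F j))"
    by (simp add: comp_fctr_def)
  with Suc show ?case by simp
qed

lemma nat_trans_id:
  assumes "cat_functor C D F"
  shows "nat_trans C D F F (\<lambda>X. Idn D (FObj F X))"
proof -
  interpret F: cat_functor C D F by fact
  show ?thesis
  proof
    show "Idn D (FObj F X) \<in> Hom D (FObj F X) (FObj F X)" if "X \<in> Obj C" for X
      using that by (intro F.D.Idn_in_Hom F.FObj_in_Obj)
    show "Comp D (Idn D (FObj F Y)) (FArr F f) = Comp D (FArr F f) (Idn D (FObj F X))"
      if "f \<in> Hom C X Y" for f X Y
      using F.FArr_in_Hom[OF that] by (simp add: F.D.Comp_Idn_left F.D.Comp_Idn_right)
  qed
qed

lemma graded_monad_pow:
  assumes "cat_functor C C F"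
  shows "graded_monad C (+) 0 (pow_gmonad C F)"
proof -
  interpret F: cat_functor C C F by fact
  interpret P: cat_functor C C "pow_fctr F n" for n
    by (rule cat_functor_pow) fact
  have idem: "Comp C (Idn C X) (Idn C X) = Idn C X" if "X \<in> Obj C" for X
    using F.C.Comp_Idn_left F.C.Idn_in_Hom that by blast
  have add: "FObj (pow_fctr F i) (FObj (pow_fctr F j) X) = FObj (pow_fctr F (i + j)) X" for i j X
    by (simp add: pow_fctr_add[symmetric] comp_fctr_def)
  show ?thesis
  proof (intro graded_monad.intro graded_monad_axioms.intro)
    show "category C" by (rule F.C.category_axioms)
    show "monoid (+) (0::nat)" by unfold_locales simp_all
    show "cat_functor C C (GFun (pow_gmonad C F) t)" for t
      by (simp add: pow_gmonad_def P.cat_functor_axioms)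
    show "nat_trans C C (comp_fctr (GFun (pow_gmonad C F) s) (GFun (pow_gmonad C F) t))
        (GFun (pow_gmonad C F) (s + t)) (Mult (pow_gmonad C F) s t)" for s t
      by (simp add: pow_gmonad_def pow_fctr_add nat_trans_id P.cat_functor_axioms)
    show "nat_trans C C id_fctr (GFun (pow_gmonad C F) 0) (Unit (pow_gmonad C F))"
      using nat_trans_id[OF cat_functor_id[OF F.C.category_axioms]]
      by (simp add: pow_gmonad_def id_fctr_def)
  qed (auto simp: pow_gmonad_def add P.FArr_Idn P.FObj_in_Obj idem add.assoc)
qed

lemma category_coalg_cat:
  assumes "cat_functor C C F"
  shows "category (coalg_cat C F)"
proof -
  interpret F: cat_functor C C F by fact
  show ?thesis
    unfolding coalg_cat_def
  proof (rule category_structured_cat)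
    show "category C" by (rule F.C.category_axioms)
    show "fst A \<in> Obj C" if "A \<in> {A. coalg C F A}" for A
      using that by (auto simp: coalg_def)
    show "coalg_hom C F A (Idn C (fst A)) A" if "A \<in> {A. coalg C F A}" for A
      using that
      by (auto simp: coalg_def coalg_hom_def F.FArr_Idn F.C.Idn_in_Hom F.C.Comp_Idn_left
          F.C.Comp_Idn_right)
    show "coalg_hom C F A (Comp C g f) D"
      if "A \<in> {A. coalg C F A}" "B \<in> {A. coalg C F A}" "D \<in> {A. coalg C F A}"
        "coalg_hom C F A f B" "coalg_hom C F B g D" for A B D f g
    proof -
      obtain X a Y b Z d where ABD: "A = (X, a)" "B = (Y, b)" "D = (Z, d)"
        by (metis surj_pair)
      from that have *: "a \<in> Hom C X (FObj F X)" "b \<in> Hom C Y (FObj F Y)" "d \<in> Hom C Z (FObj F Z)"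
        "f \<in> Hom C X Y" "g \<in> Hom C Y Z"
        "Comp C (FArr F f) a = Comp C b f" "Comp C (FArr F g) b = Comp C d g"
        by (auto simp: ABD coalg_def coalg_hom_def)
      note t = F.FArr_in_Hom[OF *(4)] F.FArr_in_Hom[OF *(5)]
      have "Comp C (FArr F (Comp C g f)) a = Comp C d (Comp C g f)"
        using F.FArr_Comp[OF *(4,5)] F.C.Comp_assoc[OF *(1) t] F.C.Comp_assoc[OF *(4,2) t(2)]
          F.C.Comp_assoc[OF *(4,5,3)] *(6,7) by simp
      then show ?thesis using F.C.Comp_in_Hom[OF *(4,5)] by (simp add: ABD coalg_hom_def)
    qed
  qed
qed

lemma category_gcoalg_cat:
  assumes "graded_monad C m e M"
  shows "category (gcoalg_cat C m e M)"
proof -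
  interpret M: graded_monad C m e M by fact
  interpret F: cat_functor C C "GFun M t" for t by (rule M.GFun_functor)
  show ?thesis
    unfolding gcoalg_cat_def
  proof (rule category_structured_cat)
    show "category C" by (rule M.category_axioms)
    show "fst A \<in> Obj C" if "A \<in> {A. gcoalg C m e M A}" for A
      using that by (auto simp: gcoalg_def)
    show "gcoalg_hom C M A (Idn C (fst A)) A" if "A \<in> {A. gcoalg C m e M A}" for A
    proof -
      obtain X a where A: "A = (X, a)" by (metis surj_pair)
      from that have X: "X \<in> Obj C" and a: "a t \<in> Hom C X (FObj (GFun M t) X)" for t
        by (auto simp: A gcoalg_def)
      show ?thesis
        by (simp add: A gcoalg_hom_def F.FArr_Idn X M.Idn_in_Hom M.Comp_Idn_left[OF a]
            M.Comp_Idn_right[OF a])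
    qed
    show "gcoalg_hom C M A (Comp C g f) D"
      if "A \<in> {A. gcoalg C m e M A}" "B \<in> {A. gcoalg C m e M A}" "D \<in> {A. gcoalg C m e M A}"
        "gcoalg_hom C M A f B" "gcoalg_hom C M B g D" for A B D f g
    proof -
      obtain X a Y b Z d where ABD: "A = (X, a)" "B = (Y, b)" "D = (Z, d)"
        by (metis surj_pair)
      from that have *: "a t \<in> Hom C X (FObj (GFun M t) X)" "b t \<in> Hom C Y (FObj (GFun M t) Y)"
        "d t \<in> Hom C Z (FObj (GFun M t) Z)" "f \<in> Hom C X Y" "g \<in> Hom C Y Z"
        "Comp C (FArr (GFun M t) f) (a t) = Comp C (b t) f"
        "Comp C (FArr (GFun M t) g) (b t) = Comp C (d t) g" for t
        by (auto simp: ABD gcoalg_def gcoalg_hom_def)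
      note t = F.FArr_in_Hom[OF *(4)] F.FArr_in_Hom[OF *(5)]
      have "Comp C (FArr (GFun M t) (Comp C g f)) (a t) = Comp C (d t) (Comp C g f)" for t
        using F.FArr_Comp[OF *(4,5), of t] M.Comp_assoc[OF *(1)[of t] t]
          M.Comp_assoc[OF *(4) *(2)[of t] t(2)] M.Comp_assoc[OF *(4,5) *(3)[of t]] *(6,7)[of t]
        by simp
      then show ?thesis using M.Comp_in_Hom[OF *(4,5)] by (simp add: ABD gcoalg_hom_def)
    qed
  qed
qed

end

theory Submission
  imports Defs
begin

text \<open>A graded coalgebra \<open>(\<gamma>\<^sub>n)\<close> of \<open>(F\<^sup>n)\<close> is determined by \<open>\<gamma>\<^sub>1\<close>, because the multiplication law
  for the degree \<open>n + 1 = 1 + n\<close> reads \<open>\<gamma>\<^bsub>n+1\<^esub> = F \<gamma>\<^sub>n \<circ> \<gamma>\<^sub>1\<close>. Conversely, this recursion extends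
  every \<open>F\<close>-coalgebra to a graded one, and it carries homomorphisms along. Both functors are
  the identity on underlying arrows.\<close>

lemma Hom_structured_cat:
  "x \<in> Hom (structured_cat C Ob H) A B \<longleftrightarrow>
    (\<exists>h. x = (A, h, B) \<and> A \<in> Ob \<and> B \<in> Ob \<and> h \<in> Hom C (fst A) (fst B) \<and> H A h B)"
  unfolding Hom_def[of "structured_cat C Ob H"] by (auto simp: structured_cat_def)

lemma structured_cat_simps:
  "Obj (structured_cat C Ob H) = Ob"
  "Idn (structured_cat C Ob H) A = (A, Idn C (fst A), A)"
  "Comp (structured_cat C Ob H) (B', g, D) (A, f, B) = (A, Comp C g f, D)"
  by (simp_all add: structured_cat_def)

text \<open>Arrows carry their endpoints, so these must be relabelled by \<open>\<phi>\<close>. The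
  underlying arrow of \<open>C\<close> can stay, since \<open>\<phi>\<close> keeps underlying
  objects, and the functor laws are then immediate.\<close>

lemma cat_functor_structured_cat:
  assumes "category (structured_cat C Ob H)" "category (structured_cat C Ob' H')"
    and ob: "\<And>A. A \<in> Ob \<Longrightarrow> \<phi> A \<in> Ob'"
    and fst_\<phi>: "\<And>A. A \<in> Ob \<Longrightarrow> fst (\<phi> A) = fst A"
    and hom: "\<And>A B h. \<lbrakk>A \<in> Ob; B \<in> Ob; h \<in> Hom C (fst A) (fst B); H A h B\<rbrakk>
      \<Longrightarrow> H' (\<phi> A) h (\<phi> B)"
  shows "cat_functor (structured_cat C Ob H) (structured_cat C Ob' H')
    \<lparr>FObj = \<phi>, FArr = (\<lambda>(A, h, B). (\<phi> A, h, \<phi> B))\<rparr>"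
proof (intro cat_functor.intro cat_functor_axioms.intro assms(1,2))
qed (auto simp: Hom_structured_cat structured_cat_simps ob fst_\<phi> hom)

text \<open>Reduces an isomorphism of categories to a bijection between structures on the same
  objects of \<open>C\<close>. That \<open>\<psi>\<close> keeps underlying objects follows from the
  same property of \<open>\<phi>\<close>.\<close>

lemma cat_isomorphic_structured_cat:
  assumes "category (structured_cat C Ob H)" "category (structured_cat C Ob' H')"
    and \<phi>: "\<And>A. A \<in> Ob \<Longrightarrow> \<phi> A \<in> Ob'" "\<And>A. A \<in> Ob \<Longrightarrow> fst (\<phi> A) = fst A"
      "\<And>A. A \<in> Ob \<Longrightarrow> \<psi> (\<phi> A) = A"
    and \<psi>: "\<And>A. A \<in> Ob' \<Longrightarrow> \<psi> A \<in> Ob" "\<And>A. A \<in> Ob' \<Longrightarrow> \<phi> (\<psi> A) = A"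
    and hom: "\<And>A B h. \<lbrakk>A \<in> Ob; B \<in> Ob; h \<in> Hom C (fst A) (fst B)\<rbrakk>
      \<Longrightarrow> H A h B \<longleftrightarrow> H' (\<phi> A) h (\<phi> B)"
  shows "cat_isomorphic (structured_cat C Ob H) (structured_cat C Ob' H')"
  unfolding cat_isomorphic_def
proof (intro exI conjI)
  have fst_\<psi>: "fst (\<psi> A) = fst A" if "A \<in> Ob'" for A
    using \<phi>(2)[OF \<psi>(1)[OF that]] \<psi>(2)[OF that] by simp
  show "cat_functor (structured_cat C Ob H) (structured_cat C Ob' H')
      \<lparr>FObj = \<phi>, FArr = (\<lambda>(A, h, B). (\<phi> A, h, \<phi> B))\<rparr>"
    using assms by (intro cat_functor_structured_cat) auto
  \<comment> \<open>Here \<open>hom\<close> is read from right to left, at \<open>\<psi> A\<close>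
    and \<open>\<psi> B\<close>, whose images under \<open>\<phi>\<close> are \<open>A\<close> and
    \<open>B\<close>.\<close>
  show "cat_functor (structured_cat C Ob' H') (structured_cat C Ob H)
      \<lparr>FObj = \<psi>, FArr = (\<lambda>(A, h, B). (\<psi> A, h, \<psi> B))\<rparr>"
    using assms(1,2) \<psi> fst_\<psi> hom by (intro cat_functor_structured_cat) auto
qed (auto simp: structured_cat_def \<phi> \<psi>)

text \<open>The recursion splits off the first step, \<open>n + 1 = 1 + n\<close>, so that one outer
  \<open>F\<close> is added each time, as in \<open>pow_fctr\<close>.\<close>

primrec iter_coalg ::
    "('o, 'm) cat \<Rightarrow> ('o, 'm, 'o, 'm) fctr \<Rightarrow> 'o \<Rightarrow> 'm \<Rightarrow> nat \<Rightarrow> 'm" where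
  "iter_coalg C F X \<gamma> 0 = Idn C X"
| "iter_coalg C F X \<gamma> (Suc n) = Comp C (FArr F (iter_coalg C F X \<gamma> n)) \<gamma>"

lemma FObj_pow_fctr_simps [simp]:
  "FObj (pow_fctr F 0) X = X"
  "FObj (pow_fctr F (Suc n)) X = FObj F (FObj (pow_fctr F n) X)"
  by (simp_all add: id_fctr_def comp_fctr_def)

lemma FArr_pow_fctr_simps [simp]:
  "FArr (pow_fctr F 0) f = f"
  "FArr (pow_fctr F (Suc n)) f = FArr F (FArr (pow_fctr F n) f)"
  by (simp_all add: id_fctr_def comp_fctr_def)

declare pow_fctr.simps [simp del]

lemma FObj_pow_fctr_add:
  "FObj (pow_fctr F i) (FObj (pow_fctr F j) X) = FObj (pow_fctr F (i + j)) X"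
  by (simp add: pow_fctr_add[symmetric] comp_fctr_def)

locale endofunctor = cat_functor C C F
  for C :: "('o, 'm) cat" and F :: "('o, 'm, 'o, 'm) fctr"
begin

lemma FArr_pow_in_Hom:
  "f \<in> Hom C X Y \<Longrightarrow> FArr (pow_fctr F n) f \<in> Hom C (FObj (pow_fctr F n) X) (FObj (pow_fctr F n) Y)"
  using cat_functor.FArr_in_Hom[OF cat_functor_pow[OF cat_functor_axioms]] .

text \<open>The multiplications are identity arrows, so they cancel once the composite is known to
  end in \<open>F^(i+j) X\<close>, which is the same object as \<open>F^i (F^j X)\<close>.\<close>

lemma gcoalg_pow_iff:
  "gcoalg C (+) 0 (pow_gmonad C F) (X, \<gamma>) \<longleftrightarrow>
    X \<in> Obj C \<and> (\<forall>n. \<gamma> n \<in> Hom C X (FObj (pow_fctr F n) X)) \<and> \<gamma> 0 = Idn C X \<and>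
    (\<forall>i j. \<gamma> (i + j) = Comp C (FArr (pow_fctr F i) (\<gamma> j)) (\<gamma> i))"
proof -
  have "Comp C (Idn C (FObj (pow_fctr F (i + j)) X)) (Comp C (FArr (pow_fctr F i) (\<gamma> j)) (\<gamma> i)) =
      Comp C (FArr (pow_fctr F i) (\<gamma> j)) (\<gamma> i)"
    if "\<And>n. \<gamma> n \<in> Hom C X (FObj (pow_fctr F n) X)" for i j
    using C.Comp_Idn_left[OF C.Comp_in_Hom[OF that[of i] FArr_pow_in_Hom[OF that[of j]]]]
    by (simp add: FObj_pow_fctr_add)
  then show ?thesis
    by (auto simp: gcoalg_def pow_gmonad_def)
qed

context
  fixes X \<gamma>
  assumes \<gamma>: "\<gamma> \<in> Hom C X (FObj F X)"
begin

lemma iter_coalg_in_Hom: "iter_coalg C F X \<gamma> n \<in> Hom C X (FObj (pow_fctr F n) X)"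
proof (induction n)
  case 0
  show ?case using C.Idn_in_Hom C.Hom_objD[OF \<gamma>] by simp
next
  case (Suc n)
  show ?case using C.Comp_in_Hom[OF \<gamma> FArr_in_Hom[OF Suc]] by simp
qed

lemma iter_coalg_1: "iter_coalg C F X \<gamma> (Suc 0) = \<gamma>"
  using C.Comp_Idn_left[OF \<gamma>] C.Hom_objD[OF \<gamma>] by (simp add: FArr_Idn)

text \<open>Induction on the outer degree \<open>i\<close>: applying \<open>F\<close> to the
  equation for \<open>i\<close> and precomposing with \<open>\<gamma>\<close> gives the one for
  \<open>i + 1\<close>, up to associativity.\<close>

lemma iter_coalg_add:
  "iter_coalg C F X \<gamma> (i + j) =
    Comp C (FArr (pow_fctr F i) (iter_coalg C F X \<gamma> j)) (iter_coalg C F X \<gamma> i)"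
proof (induction i)
  case 0
  show ?case using C.Comp_Idn_right[OF iter_coalg_in_Hom] by simp
next
  case (Suc i)
  note i = iter_coalg_in_Hom[of i] and j = FArr_pow_in_Hom[OF iter_coalg_in_Hom[of j], of i]
  show ?case
    using Suc FArr_Comp[OF i j] C.Comp_assoc[OF \<gamma> FArr_in_Hom[OF i] FArr_in_Hom[OF j]] by simp
qed

lemma gcoalg_iter_coalg: "gcoalg C (+) 0 (pow_gmonad C F) (X, iter_coalg C F X \<gamma>)"
  using C.Hom_objD[OF \<gamma>] iter_coalg_in_Hom iter_coalg_add by (simp add: gcoalg_pow_iff)

text \<open>The square for degree \<open>n + 1\<close> is the coalgebra square of \<open>h\<close>
  pasted with the \<open>F\<close>-image of the square for degree \<open>n\<close>.\<close>

lemma iter_coalg_hom: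
  assumes \<delta>: "\<delta> \<in> Hom C Y (FObj F Y)" and h: "h \<in> Hom C X Y"
    and eq: "Comp C (FArr F h) \<gamma> = Comp C \<delta> h"
  shows "Comp C (FArr (pow_fctr F n) h) (iter_coalg C F X \<gamma> n) = Comp C (iter_coalg C F Y \<delta> n) h"
proof (induction n)
  case 0
  show ?case using C.Comp_Idn_left[OF h] C.Comp_Idn_right[OF h] by simp
next
  case (Suc n)
  \<comment> \<open>Within this context the typing lemma is fixed to \<open>\<gamma>\<close>; its
    exported form supplies the case of \<open>\<delta>\<close>.\<close>
  note Xn = iter_coalg_in_Hom[of n] and Yn = endofunctor.iter_coalg_in_Hom[OF endofunctor_axioms \<delta>, of n]
    and hn = FArr_pow_in_Hom[OF h, of n]
  have "Comp C (FArr F (FArr (pow_fctr F n) h)) (Comp C (FArr F (iter_coalg C F X \<gamma> n)) \<gamma>) =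
      Comp C (FArr F (Comp C (FArr (pow_fctr F n) h) (iter_coalg C F X \<gamma> n))) \<gamma>"
    using C.Comp_assoc[OF \<gamma> FArr_in_Hom[OF Xn] FArr_in_Hom[OF hn]] FArr_Comp[OF Xn hn] by simp
  also have "\<dots> = Comp C (FArr F (iter_coalg C F Y \<delta> n)) (Comp C (FArr F h) \<gamma>)"
    using C.Comp_assoc[OF \<gamma> FArr_in_Hom[OF h] FArr_in_Hom[OF Yn]] FArr_Comp[OF h Yn] Suc by simp
  also have "\<dots> = Comp C (Comp C (FArr F (iter_coalg C F Y \<delta> n)) \<delta>) h"
    using C.Comp_assoc[OF h \<delta> FArr_in_Hom[OF Yn]] eq by simp
  finally show ?case by simp
qed

end

lemma iter_coalg_unique:
  assumes "gcoalg C (+) 0 (pow_gmonad C F) (X, \<gamma>)"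
  shows "iter_coalg C F X (\<gamma> (Suc 0)) = \<gamma>"
proof
  show "iter_coalg C F X (\<gamma> (Suc 0)) n = \<gamma> n" for n
  proof (induction n)
    case 0
    show ?case using assms by (simp only: gcoalg_pow_iff iter_coalg.simps)
  next
    case (Suc n)
    \<comment> \<open>The order of the summands matters: \<open>n + Suc 0\<close> would instead give
      \<open>F^n\<close> of the degree-one component after \<open>\<gamma> n\<close>.\<close>
    have "\<gamma> (Suc 0 + n) = Comp C (FArr (pow_fctr F (Suc 0)) (\<gamma> n)) (\<gamma> (Suc 0))"
      using assms unfolding gcoalg_pow_iff by blast
    then have "\<gamma> (Suc n) = Comp C (FArr F (\<gamma> n)) (\<gamma> (Suc 0))"
      by (simp only: FArr_pow_fctr_simps add_Suc add_0)
    with Suc show ?case by (simp only: iter_coalg.simps)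
  qed
qed

text \<open>From left to right the square propagates to all degrees; from right to left only degree
  one is read off.\<close>

lemma coalg_hom_iff_gcoalg_hom:
  assumes \<gamma>: "\<gamma> \<in> Hom C X (FObj F X)" and \<delta>: "\<delta> \<in> Hom C Y (FObj F Y)"
  shows "coalg_hom C F (X, \<gamma>) h (Y, \<delta>) \<longleftrightarrow>
    gcoalg_hom C (pow_gmonad C F) (X, iter_coalg C F X \<gamma>) h (Y, iter_coalg C F Y \<delta>)"
    (is "_ \<longleftrightarrow> ?G")
proof
  show ?G if "coalg_hom C F (X, \<gamma>) h (Y, \<delta>)"
    using that iter_coalg_hom[OF \<gamma> \<delta>] by (auto simp: coalg_hom_def gcoalg_hom_def pow_gmonad_def)
next
  assume ?G
  then have "h \<in> Hom C X Y"
    and "Comp C (FArr (pow_fctr F (Suc 0)) h) (iter_coalg C F X \<gamma> (Suc 0)) =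
      Comp C (iter_coalg C F Y \<delta> (Suc 0)) h"
    by (auto simp: gcoalg_hom_def pow_gmonad_def simp del: iter_coalg.simps FArr_pow_fctr_simps)
  then show "coalg_hom C F (X, \<gamma>) h (Y, \<delta>)"
    unfolding iter_coalg_1[OF \<gamma>] iter_coalg_1[OF \<delta>] by (simp add: coalg_hom_def)
qed

end

theorem proposition2p9:
  fixes C :: "('o, 'm) cat" and F :: "('o, 'm, 'o, 'm) fctr"
  assumes "category C" and "cat_functor C C F"
  shows "cat_isomorphic (coalg_cat C F) (gcoalg_cat C (+) (0::nat) (pow_gmonad C F))"
proof -
  interpret endofunctor C F
    using assms(2) by (rule endofunctor.intro)
  let ?\<phi> = "\<lambda>(X, \<gamma>). (X, iter_coalg C F X \<gamma>)" and ?\<psi> = "\<lambda>(X, \<gamma>). (X, \<gamma> (Suc 0))"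
  show ?thesis
    unfolding coalg_cat_def gcoalg_cat_def
  proof (rule cat_isomorphic_structured_cat[where \<phi> = ?\<phi> and \<psi> = ?\<psi>])
    show "category (structured_cat C {A. coalg C F A} (coalg_hom C F))"
      using category_coalg_cat[OF assms(2)] by (simp add: coalg_cat_def)
    show "category (structured_cat C {A. gcoalg C (+) 0 (pow_gmonad C F) A}
        (gcoalg_hom C (pow_gmonad C F)))"
      using category_gcoalg_cat[OF graded_monad_pow[OF assms(2)]] by (simp add: gcoalg_cat_def)
    show "?\<psi> A \<in> {A. coalg C F A}" if "A \<in> {A. gcoalg C (+) 0 (pow_gmonad C F) A}" for A
    proof -
      obtain X \<gamma> where A: "A = (X, \<gamma>)" by fastforce
      with that have "X \<in> Obj C" "\<gamma> (Suc 0) \<in> Hom C X (FObj (pow_fctr F (Suc 0)) X)"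
        unfolding A mem_Collect_eq gcoalg_pow_iff by blast+
      then show ?thesis by (simp add: A coalg_def)
    qed
  \<comment> \<open>The two round trips are \<open>iter_coalg_1\<close> and
    \<open>iter_coalg_unique\<close>. The recursion stays folded so that \<open>iter_coalg_1\<close>
    can match.\<close>
  qed (auto simp: coalg_def gcoalg_iter_coalg iter_coalg_1 iter_coalg_unique
      coalg_hom_iff_gcoalg_hom simp del: iter_coalg.simps)
qed

end
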